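(* Let $\mu\in\Delta_m$, $\nu\in\Delta_n$ have positive entries, $C\in\mathbb R^{m\times n}$, and let $(f(t),g(t))_{t\ge0}$ be the cold Sinkhorn dynamics from any initial pair $(\bar f^0,\bar g^0)\in\partial\mathcal F$. Then for every $t\ge0$, $(f(t),g(t))\in\partial\mathcal F$.
   Context: $\Delta_N$ is the probability simplex in $\mathbb R^N$; $H(p|q)=\sum_I p_I\log(p_I/q_I)$ is relative entropy. **Dual OT polytope.** $\mathcal F=\{(f,g)\in\mathbb R^m\times\mathbb R^n:\ f_i+g_j\le C_{ij}\ \forall i,j\}$; $\partial\mathcal F$ is its Pareto frontier: the set of $(f,g)\in\mathcal F$ such that the only $(f',g')\in\mathcal F$ with $f'_i\ge f_i$ and $g'_j\ge g_j$ for all $i,j$ is $(f,g)$ itself. Equivalently, $(f,g)\in\partial\mathcal F$ iff $f_i+g_j\le C_{ij}$ for all $i,j$ and the bipartite graph on $\{1,\dots,m\}\sqcup\{1,\dots,n\}$ with edge set $\{(i,j): f_i+g_j=C_{ij}\}$ has no isolated vertex. **The vectors $v^*(\mathcal E),w^*(\mathcal E)$.** For $\mathcal E\subset\{1,\dots,m\}\times\{1,\dots,n\}$, $\Delta_{\mathcal E}$ is the set of probability distributions on $\mathcal E$; for $\pi\in\Delta_{\mathcal E}$, $(X_\sharp\pi)_i=\sum_{j:(i,j)\in\mathcal E}\pi_{ij}$ and $(Y_\sharp\pi)_j=\sum_{i:(i,j)\in\mathcal E}\pi_{ij}$. If the bipartite graph on $\{1,\dots,m\}\sqcup\{1,\dots,n\}$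 with edge set $\mathcal E$ has no isolated vertex, let $\mu^*(\mathcal E)$ be the minimizer of $H(\bar\mu|\mu)$ over $\bar\mu$ such that there is $Q\in\Delta_{\mathcal E}$ with $X_\sharp Q=\bar\mu$, $Y_\sharp Q=\nu$; let $\nu^*(\mathcal E)$ be the minimizer of $H(\bar\nu|\nu)$ over $\bar\nu$ such that there is $P\in\Delta_{\mathcal E}$ with $X_\sharp P=\mu$, $Y_\sharp P=\bar\nu$; and $v^*(\mathcal E)_i=\log(\mu_i/\mu^*_i(\mathcal E))$, $w^*(\mathcal E)_j=\log(\nu_j/\nu^*_j(\mathcal E))$. **Cold Sinkhorn dynamics.** For $(\bar f^0,\bar g^0)\in\partial\mathcal F$, it is the continuous curve with $f(0)=\bar f^0$, $g(0)=\bar g^0$ and $\frac{d}{dt}f(t)=\bar v^\ell$, $\frac{d}{dt}g(t)=\bar w^\ell$ for $t\in[t_\ell,t_{\ell+1})$, $\ell\le L$, where $(t_\ell,\bar v^\ell,\bar w^\ell,\mathcal E^\ell)_{\ell\le L}$ is defined recursively: $t_0=0$, $\mathcal E^0=\{(i,j):\bar f^0_i+\bar g^0_j-C_{ij}=0\}$, $\bar v^0=v^*(\mathcal E^0)$, $\bar w^0=w^*(\mathcal E^0)$; and for $\ell\ge0$, $$t_{\ell+1}=\inf\Big\{t\ge t_\ell:\ \max_{(i,j)\notin\mathcal E^\ell} f_i(t_\ell)+g_j(t_\ell)+(t-t_\ell)(\bar v^\ell_i+\bar w^\ell_j)-C_{ij}\ge0\Big\}.$$ If $t_{\ell+1}<\infty$,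 then $\mathcal E^{\ell+1}=\{(i,j): f_i(t_\ell)+g_j(t_\ell)+(t_{\ell+1}-t_\ell)(\bar v^\ell_i+\bar w^\ell_j)-C_{ij}=0\}$, $\bar v^{\ell+1}=v^*(\mathcal E^{\ell+1})$, $\bar w^{\ell+1}=w^*(\mathcal E^{\ell+1})$. If $t_{\ell+1}=\infty$, then $L=\ell$ and the sequence stops. Set $t_{L+1}=\infty$. *)

theory Defs
  imports "HOL-Analysis.Analysis"
begin

text \<open>
  The index sets \<open>{1..m}\<close> and \<open>{1..n}\<close> are the finite types \<open>'m\<close> and \<open>'n\<close>. A cost matrix or a
  plan is a matrix of type \<open>real ^ 'n ^ 'm\<close>, row index first.
\<close>

definition prob_simplex :: "(real ^ 'k) set" where
  "prob_simplex = {p. (\<forall>i. 0 \<le> p $ i) \<and> (\<Sum>i\<in>UNIV. p $ i) = 1}"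

text \<open>The convention \<open>0 * log 0 = 0\<close> holds automatically. Only used with \<open>q\<close> positive.\<close>

definition rel_entropy :: "real ^ 'k \<Rightarrow> real ^ 'k \<Rightarrow> real" where
  "rel_entropy p q = (\<Sum>i\<in>UNIV. p $ i * ln (p $ i / q $ i))"

definition dual_polytope :: "real ^ 'n ^ 'm \<Rightarrow> ((real ^ 'm) \<times> (real ^ 'n)) set" where
  "dual_polytope C = {(f, g). \<forall>i j. f $ i + g $ j \<le> C $ i $ j}"

definition pareto_frontier :: "real ^ 'n ^ 'm \<Rightarrow> ((real ^ 'm) \<times> (real ^ 'n)) set" where
  "pareto_frontier C =
     {(f, g). (f, g) \<in> dual_polytope C \<and>
        (\<forall>f' g'. (f', g') \<in> dual_polytope C \<and> (\<forall>i. f' $ i \<ge> f $ i) \<and> (\<forall>j. g' $ j \<ge> g $ j)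
           \<longrightarrow> (f', g') = (f, g))}"

text \<open>A distribution on a set of edges is extended by zero to a full matrix.\<close>

definition edge_simplex :: "('m \<times> 'n) set \<Rightarrow> (real ^ 'n ^ 'm) set" where
  "edge_simplex E =
     {\<pi>. (\<forall>i j. 0 \<le> \<pi> $ i $ j) \<and> (\<forall>i j. (i, j) \<notin> E \<longrightarrow> \<pi> $ i $ j = 0) \<and>
         (\<Sum>(i, j)\<in>E. \<pi> $ i $ j) = 1}"

definition marginal_X :: "('m \<times> 'n) set \<Rightarrow> real ^ 'n ^ 'm \<Rightarrow> real ^ 'm" where
  "marginal_X E \<pi> = (\<chi> i. \<Sum>j | (i, j) \<in> E. \<pi> $ i $ j)"

definition marginal_Y :: "('m \<times> 'n) set \<Rightarrow> real ^ 'n ^ 'm \<Rightarrow> real ^ 'n" where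
  "marginal_Y E \<pi> = (\<chi> j. \<Sum>i | (i, j) \<in> E. \<pi> $ i $ j)"

text \<open>
  The two minimizers are unique (for \<open>\<mu>\<close>, \<open>\<nu>\<close> positive probability vectors) when the bipartite
  graph \<open>E\<close> has no isolated vertex. Otherwise the values of the following four functions
  are unspecified.
\<close>

definition mu_star :: "real ^ 'm \<Rightarrow> real ^ 'n \<Rightarrow> ('m \<times> 'n) set \<Rightarrow> real ^ 'm" where
  "mu_star \<mu> \<nu> E =
     (ARG_MIN (\<lambda>\<mu>'. rel_entropy \<mu>' \<mu>) \<mu>'.
        \<exists>Q\<in>edge_simplex E. marginal_X E Q = \<mu>' \<and> marginal_Y E Q = \<nu>)"

definition nu_star :: "real ^ 'm \<Rightarrow> real ^ 'n \<Rightarrow> ('m \<times> 'n) set \<Rightarrow> real ^ 'n" where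
  "nu_star \<mu> \<nu> E =
     (ARG_MIN (\<lambda>\<nu>'. rel_entropy \<nu>' \<nu>) \<nu>'.
        \<exists>P\<in>edge_simplex E. marginal_X E P = \<mu> \<and> marginal_Y E P = \<nu>')"

definition v_star :: "real ^ 'm \<Rightarrow> real ^ 'n \<Rightarrow> ('m \<times> 'n) set \<Rightarrow> real ^ 'm" where
  "v_star \<mu> \<nu> E = (\<chi> i. ln (\<mu> $ i / mu_star \<mu> \<nu> E $ i))"

definition w_star :: "real ^ 'm \<Rightarrow> real ^ 'n \<Rightarrow> ('m \<times> 'n) set \<Rightarrow> real ^ 'n" where
  "w_star \<mu> \<nu> E = (\<chi> j. ln (\<nu> $ j / nu_star \<mu> \<nu> E $ j))"

text \<open>
  \<open>excess\<close> is the constraint value \<open>f\<^sub>i + g\<^sub>j - C\<^sub>i\<^sub>j\<close> after time \<open>s\<close> when starting at \<open>(f, g)\<close> and moving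
  with the constant velocity given by the edge set \<open>E\<close>.
\<close>

definition excess ::
  "real ^ 'm \<Rightarrow> real ^ 'n \<Rightarrow> real ^ 'n ^ 'm \<Rightarrow> real ^ 'm \<Rightarrow> real ^ 'n \<Rightarrow> ('m \<times> 'n) set \<Rightarrow>
   real \<Rightarrow> 'm \<Rightarrow> 'n \<Rightarrow> real" where
  "excess \<mu> \<nu> C f g E s i j =
     f $ i + g $ j + s * (v_star \<mu> \<nu> E $ i + w_star \<mu> \<nu> E $ j) - C $ i $ j"

text \<open>
  The switching time following a switch at time \<open>t\<close> to the edge set \<open>E\<close>, along curves \<open>f\<close>, \<open>g\<close>.
  In \<open>ereal\<close> the maximum over no edges is \<open>-\<infinity>\<close> and the infimum of the empty set is \<open>\<infinity>\<close>.
\<close>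

definition next_time ::
  "real ^ 'm \<Rightarrow> real ^ 'n \<Rightarrow> real ^ 'n ^ 'm \<Rightarrow> (real \<Rightarrow> real ^ 'm) \<Rightarrow> (real \<Rightarrow> real ^ 'n) \<Rightarrow>
   real \<Rightarrow> ('m \<times> 'n) set \<Rightarrow> ereal" where
  "next_time \<mu> \<nu> C f g t E =
     Inf (ereal ` {s. s \<ge> t \<and> (SUP (i, j)\<in>- E. ereal (excess \<mu> \<nu> C (f t) (g t) E (s - t) i j)) \<ge> 0})"

text \<open>
  \<open>phase \<mu> \<nu> C f g l = Some (t, E)\<close> means that \<open>l \<le> L\<close> and that \<open>t\<close>, \<open>E\<close> are the \<open>l\<close>-th switching
  time and edge set; it is \<open>None\<close> when \<open>l > L\<close>. Since the recursion reads off the position of the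
  curve at the switching times, \<open>f\<close> and \<open>g\<close> are parameters. Finiteness of \<open>L\<close> is not built in.
\<close>

primrec phase ::
  "real ^ 'm \<Rightarrow> real ^ 'n \<Rightarrow> real ^ 'n ^ 'm \<Rightarrow> (real \<Rightarrow> real ^ 'm) \<Rightarrow> (real \<Rightarrow> real ^ 'n) \<Rightarrow>
   nat \<Rightarrow> (real \<times> ('m \<times> 'n) set) option" where
  "phase \<mu> \<nu> C f g 0 = Some (0, {(i, j). f 0 $ i + g 0 $ j - C $ i $ j = 0})"
| "phase \<mu> \<nu> C f g (Suc l) =
     (case phase \<mu> \<nu> C f g l of
        None \<Rightarrow> None
      | Some (t, E) \<Rightarrow>
          (let T = next_time \<mu> \<nu> C f g t E in
           if T < \<infinity>
           then Some (real_of_ereal T,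
                      {(i, j). excess \<mu> \<nu> C (f t) (g t) E (real_of_ereal T - t) i j = 0})
           else None))"

text \<open>
  The derivative is taken within \<open>[t\<^sub>l, t\<^sub>l\<^sub>+\<^sub>1)\<close>, hence is the right derivative at \<open>t\<^sub>l\<close>. The values
  of the curve at negative times are irrelevant.
\<close>

definition cold_sinkhorn ::
  "real ^ 'm \<Rightarrow> real ^ 'n \<Rightarrow> real ^ 'n ^ 'm \<Rightarrow> real ^ 'm \<Rightarrow> real ^ 'n \<Rightarrow>
   (real \<Rightarrow> real ^ 'm) \<Rightarrow> (real \<Rightarrow> real ^ 'n) \<Rightarrow> bool" where
  "cold_sinkhorn \<mu> \<nu> C f0 g0 f g \<longleftrightarrow>
     continuous_on {0..} f \<and> continuous_on {0..} g \<and> f 0 = f0 \<and> g 0 = g0 \<and>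
     (\<forall>l t E. phase \<mu> \<nu> C f g l = Some (t, E) \<longrightarrow>
        (let J = {s. t \<le> s \<and> ereal s < next_time \<mu> \<nu> C f g t E} in
         \<forall>s\<in>J. (f has_vector_derivative v_star \<mu> \<nu> E) (at s within J) \<and>
               (g has_vector_derivative w_star \<mu> \<nu> E) (at s within J)))"

end

theory Submission
  imports Defs "HOL-Real_Asymp.Real_Asymp"
begin

text \<open>
  A feasible pair \<open>(f, g)\<close> lies on the Pareto frontier iff its tight edges
  \<open>f\<^sub>i + g\<^sub>j = C\<^sub>i\<^sub>j\<close> leave no vertex isolated (\<open>pareto_frontier_iff\<close>). So it suffices that, during a
  phase with edge set \<open>E\<close>, the velocities \<open>v = v\<^sup>*(E)\<close>, \<open>w = w\<^sup>*(E)\<close> satisfy \<open>v\<^sub>i + w\<^sub>j \<le> 0\<close> on \<open>E\<close>, with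
  equality on a subset of \<open>E\<close> that still touches every vertex: the constraints in \<open>E\<close> are then not
  violated, enough of them stay tight, and the constraints outside \<open>E\<close> are watched by the definition
  of the next switching time.

  These properties are the optimality conditions of the entropy minimization. If mass can be moved
  within a column from a row \<open>a\<close> to a row \<open>i\<close> along \<open>E\<close>, then at the optimum the ratio
  \<open>\<mu>\<^sup>*\<^sub>a / \<mu>\<^sub>a\<close> is at most \<open>\<mu>\<^sup>*\<^sub>i / \<mu>\<^sub>i\<close>, since otherwise moving a little mass would decrease the entropy
  (\<open>minimizer_feeds_lowest_ratio\<close>). Hence the optimal plan \<open>Q\<close> charges in each column only rows of
  lowest ratio, and minus the logarithm of that ratio is the largest \<open>v\<^sub>i\<close> available to the column;
  call it \<open>- w\<^sub>j\<close>. The triple \<open>(v, w, Q)\<close> is recorded as a \<open>certificate\<close>. Multiplying row \<open>i\<close> of \<open>Q\<close>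
  by \<open>exp v\<^sub>i\<close> turns it into a certificate of the problem with \<open>\<mu>\<close> and \<open>\<nu>\<close> exchanged, and
  certificates are unique; so the \<open>w\<close> just found is \<open>w\<^sup>*(E)\<close>, although \<open>w\<^sup>*(E)\<close> is defined through
  a different minimization problem (\<open>star_certificate\<close>).

  It remains to exclude that switching times accumulate, as the dynamics would say nothing about
  the curve beyond an accumulation point. The number \<open>\<Sum>\<^sub>j \<nu>\<^sub>j w\<^sub>j\<close>, which is the minimal
  entropy \<open>H(\<mu>\<^sup>*(E) | \<mu>)\<close>, strictly decreases from one phase to the next: the support of the old plan stays tight, so
  the old plan is still admissible for the new edge set; and equality would force equal velocities,
  which is impossible because an edge that just became tight had \<open>v\<^sub>i + w\<^sub>j > 0\<close> before the switch and
  has \<open>v\<^sub>i + w\<^sub>j \<le> 0\<close> after it. So no edge set occurs twice, and there are finitely many phases.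
\<close>

section \<open>The Pareto frontier and isolated vertices\<close>

definition no_isolated_vertex :: "('m \<times> 'n) set \<Rightarrow> bool" where
  "no_isolated_vertex E \<longleftrightarrow> (\<forall>i. \<exists>j. (i, j) \<in> E) \<and> (\<forall>j. \<exists>i. (i, j) \<in> E)"

definition tight_edges :: "real ^ 'n ^ 'm \<Rightarrow> real ^ 'm \<Rightarrow> real ^ 'n \<Rightarrow> ('m \<times> 'n) set" where
  "tight_edges C f g = {(i, j). f $ i + g $ j = C $ i $ j}"

text \<open>If row \<open>i\<close> had no tight edge, \<open>f\<^sub>i\<close> could be raised by the smallest slack of the row.\<close>

lemma pareto_frontier_row_tight:
  fixes C :: "real ^ 'n ^ 'm"
  assumes "(f, g) \<in> pareto_frontier C"
  shows "\<exists>j. (i, j) \<in> tight_edges C f g"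
proof (rule ccontr)
  assume "\<not> ?thesis"
  then have not_tight: "f $ i + g $ j \<noteq> C $ i $ j" for j
    by (auto simp: tight_edges_def)
  have feas: "f $ k + g $ j \<le> C $ k $ j" for k j
    using assms by (auto simp: pareto_frontier_def dual_polytope_def)
  have slack: "C $ i $ j - f $ i - g $ j > 0" for j
    using feas[of i j] not_tight[of j] by simp
  define e where "e = Min (range (\<lambda>j. C $ i $ j - f $ i - g $ j))"
  have e_pos: "e > 0" and e_le: "e \<le> C $ i $ j - f $ i - g $ j" for j
    using slack by (auto simp: e_def)
  define f' where "f' = (\<chi> k. if k = i then f $ i + e else f $ k)"
  have "(f', g) \<in> dual_polytope C"
    using feas e_le by (auto simp: dual_polytope_def f'_def algebra_simps)
  moreover have "\<forall>k. f' $ k \<ge> f $ k"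
    using e_pos by (auto simp: f'_def)
  ultimately have "f' = f"
    using assms by (auto simp: pareto_frontier_def)
  then have "f' $ i = f $ i" by simp
  then show False
    using e_pos by (simp add: f'_def)
qed

lemma pareto_frontier_column_tight:
  fixes C :: "real ^ 'n ^ 'm"
  assumes "(f, g) \<in> pareto_frontier C"
  shows "\<exists>i. (i, j) \<in> tight_edges C f g"
proof (rule ccontr)
  assume "\<not> ?thesis"
  then have not_tight: "f $ i + g $ j \<noteq> C $ i $ j" for i
    by (auto simp: tight_edges_def)
  have feas: "f $ i + g $ k \<le> C $ i $ k" for i k
    using assms by (auto simp: pareto_frontier_def dual_polytope_def)
  have slack: "C $ i $ j - f $ i - g $ j > 0" for i
    using feas[of i j] not_tight[of i] by simp
  define e where "e = Min (range (\<lambda>i. C $ i $ j - f $ i - g $ j))"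
  have e_pos: "e > 0" and e_le: "e \<le> C $ i $ j - f $ i - g $ j" for i
    using slack by (auto simp: e_def)
  define g' where "g' = (\<chi> k. if k = j then g $ j + e else g $ k)"
  have "(f, g') \<in> dual_polytope C"
    using feas e_le by (auto simp: dual_polytope_def g'_def algebra_simps)
  moreover have "\<forall>k. g' $ k \<ge> g $ k"
    using e_pos by (auto simp: g'_def)
  ultimately have "g' = g"
    using assms by (auto simp: pareto_frontier_def)
  then have "g' $ j = g $ j" by simp
  then show False
    using e_pos by (simp add: g'_def)
qed

text \<open>
  Conversely, along a tight edge neither \<open>f\<^sub>i\<close> nor \<open>g\<^sub>j\<close> can grow unless the other one shrinks, so a
  dominating feasible pair agrees with \<open>(f, g)\<close> at every endpoint of a tight edge.
\<close>

lemma pareto_frontier_iff: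
  fixes C :: "real ^ 'n ^ 'm"
  shows "(f, g) \<in> pareto_frontier C \<longleftrightarrow>
    (f, g) \<in> dual_polytope C \<and> no_isolated_vertex (tight_edges C f g)"
proof
  assume "(f, g) \<in> pareto_frontier C"
  then show "(f, g) \<in> dual_polytope C \<and> no_isolated_vertex (tight_edges C f g)"
    using pareto_frontier_row_tight[of f g C] pareto_frontier_column_tight[of f g C]
    by (auto simp: pareto_frontier_def no_isolated_vertex_def)
next
  assume A: "(f, g) \<in> dual_polytope C \<and> no_isolated_vertex (tight_edges C f g)"
  have "f' = f \<and> g' = g"
    if F: "(f', g') \<in> dual_polytope C" and fge: "\<forall>i. f' $ i \<ge> f $ i" and gge: "\<forall>j. g' $ j \<ge> g $ j"
    for f' g'
  proof -
    have eq: "f' $ i = f $ i \<and> g' $ j = g $ j" if "(i, j) \<in> tight_edges C f g" for i j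
    proof -
      have "f' $ i + g' $ j \<le> C $ i $ j" using F by (auto simp: dual_polytope_def)
      moreover have "f $ i + g $ j = C $ i $ j" using that by (auto simp: tight_edges_def)
      moreover have "f' $ i \<ge> f $ i" "g' $ j \<ge> g $ j" using fge gge by auto
      ultimately show ?thesis by linarith
    qed
    show ?thesis
      unfolding vec_eq_iff using A eq unfolding no_isolated_vertex_def by blast
  qed
  then show "(f, g) \<in> pareto_frontier C"
    using A by (auto simp: pareto_frontier_def)
qed

section \<open>Entropy minimizers\<close>

text \<open>
  Total mass one follows from the prescribed column sums, and marginals may be taken over all
  entries since a plan vanishes off \<open>E\<close>.
\<close>

lemma feasible_plan_iff:
  fixes Q :: "real ^ 'n ^ 'm"
  assumes "\<nu> \<in> prob_simplex"
  shows "Q \<in> edge_simplex E \<and> marginal_Y E Q = \<nu> \<longleftrightarrow>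
    (\<forall>i j. 0 \<le> Q $ i $ j) \<and> (\<forall>i j. (i, j) \<notin> E \<longrightarrow> Q $ i $ j = 0) \<and>
    (\<forall>j. (\<Sum>i\<in>UNIV. Q $ i $ j) = \<nu> $ j)"
proof -
  have "(\<Sum>(i, j)\<in>E. Q $ i $ j) = (\<Sum>j\<in>UNIV. \<Sum>i\<in>UNIV. Q $ i $ j)"
    and "(\<Sum>i | (i, j) \<in> E. Q $ i $ j) = (\<Sum>i\<in>UNIV. Q $ i $ j)"
    if off: "\<forall>i j. (i, j) \<notin> E \<longrightarrow> Q $ i $ j = 0" for j
  proof -
    have "(\<Sum>(i, j)\<in>E. Q $ i $ j) = (\<Sum>(i, j)\<in>UNIV \<times> UNIV. Q $ i $ j)"
      using off by (intro sum.mono_neutral_left) auto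
    also have "\<dots> = (\<Sum>i\<in>UNIV. \<Sum>j\<in>UNIV. Q $ i $ j)"
      by (simp only: sum.cartesian_product)
    also have "\<dots> = (\<Sum>j\<in>UNIV. \<Sum>i\<in>UNIV. Q $ i $ j)"
      by (rule sum.swap)
    finally show "(\<Sum>(i, j)\<in>E. Q $ i $ j) = (\<Sum>j\<in>UNIV. \<Sum>i\<in>UNIV. Q $ i $ j)" .
    show "(\<Sum>i | (i, j) \<in> E. Q $ i $ j) = (\<Sum>i\<in>UNIV. Q $ i $ j)"
      using off by (intro sum.mono_neutral_left) auto
  qed
  moreover have "(\<Sum>j\<in>UNIV. \<nu> $ j) = 1"
    using assms by (simp add: prob_simplex_def)
  ultimately show ?thesis
    by (auto simp: edge_simplex_def marginal_Y_def vec_eq_iff)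
qed

lemma marginal_X_full:
  assumes "Q \<in> edge_simplex E"
  shows "marginal_X E Q $ i = (\<Sum>j\<in>UNIV. Q $ i $ j)"
  using assms by (auto simp: marginal_X_def edge_simplex_def intro!: sum.mono_neutral_left)

lemma continuous_on_entropy_term:
  fixes q :: real
  assumes "q > 0"
  shows "continuous_on {0..} (\<lambda>x. x * ln (x / q))"
proof -
  let ?h = "\<lambda>x. x * ln (x / q)"
  have pos: "(?h \<longlongrightarrow> ?h x) (at x within {0..})" if "x > 0" for x
    using that assms by (intro tendsto_intros) auto
  have "(?h \<longlongrightarrow> 0) (at_right 0)"
    using assms by real_asymp
  moreover have "at (0::real) within {0..} = at_right 0"
  proof -
    have "{0::real..} - {0} = {0<..} - {0}" by auto
    then show ?thesis by (simp add: at_within_def)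
  qed
  ultimately have zero: "(?h \<longlongrightarrow> ?h 0) (at 0 within {0..})" by simp
  show ?thesis
    unfolding continuous_on_def
  proof
    fix x :: real assume "x \<in> {0..}"
    then show "(?h \<longlongrightarrow> ?h x) (at x within {0..})"
      using pos[of x] zero by (cases "x = 0") auto
  qed
qed

text \<open>
  The plans on \<open>E\<close> with column sums \<open>\<nu>\<close> form a compact set, nonempty because every column has an edge,
  and the entropy of the row sums is continuous up to the boundary of the simplex.
\<close>

lemma entropy_minimizer_exists:
  fixes \<mu> :: "real ^ 'm" and \<nu> :: "real ^ 'n"
  assumes \<mu>: "\<forall>i. \<mu> $ i > 0" and \<nu>: "\<nu> \<in> prob_simplex"
    and E: "no_isolated_vertex E"
  shows "is_arg_min (\<lambda>\<mu>'. rel_entropy \<mu>' \<mu>)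
    (\<lambda>\<mu>'. \<exists>Q\<in>edge_simplex E. marginal_X E Q = \<mu>' \<and> marginal_Y E Q = \<nu>) (mu_star \<mu> \<nu> E)"
proof -
  define K where "K = {Q \<in> edge_simplex E. marginal_Y E Q = \<nu>}"
  have K: "K = {Q. (\<forall>i j. 0 \<le> Q $ i $ j) \<and> (\<forall>i j. (i, j) \<notin> E \<longrightarrow> Q $ i $ j = 0) \<and>
    (\<forall>j. (\<Sum>i\<in>UNIV. Q $ i $ j) = \<nu> $ j)}"
    unfolding K_def using feasible_plan_iff[OF \<nu>] by blast
  have "norm Q \<le> 1" if "Q \<in> K" for Q
  proof -
    have "norm Q \<le> (\<Sum>i\<in>UNIV. norm (Q $ i))"
      unfolding norm_vec_def[of Q] by (rule L2_set_le_sum) auto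
    also have "\<dots> \<le> (\<Sum>i\<in>UNIV. \<Sum>j\<in>UNIV. \<bar>Q $ i $ j\<bar>)"
      by (intro sum_mono norm_le_l1_cart)
    also have "\<dots> = (\<Sum>i\<in>UNIV. \<Sum>j\<in>UNIV. Q $ i $ j)"
      using that by (auto simp: K intro!: sum.cong)
    also have "\<dots> = (\<Sum>j\<in>UNIV. \<Sum>i\<in>UNIV. Q $ i $ j)"
      by (rule sum.swap)
    also have "\<dots> = 1"
      using that \<nu> by (auto simp: K prob_simplex_def)
    finally show ?thesis .
  qed
  then have "bounded K" by (auto simp: bounded_iff)
  moreover have "closed K"
    unfolding K by (intro closed_Collect_conj closed_Collect_all closed_Collect_imp open_Collect_const
        closed_Collect_le closed_Collect_eq continuous_intros)
  ultimately have "compact K" by (simp add: compact_eq_bounded_closed)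
  moreover have "K \<noteq> {}"
  proof -
    obtain r where r: "(r j, j) \<in> E" for j
      using E unfolding no_isolated_vertex_def by metis
    \<comment> \<open>Column \<open>j\<close> sends all its mass along the single edge \<open>(r j, j)\<close>.\<close>
    have "(\<chi> i j. if i = r j then \<nu> $ j else 0) \<in> K"
      using r \<nu> by (auto simp: K prob_simplex_def)
    then show ?thesis by blast
  qed
  moreover have "continuous_on K (\<lambda>Q. rel_entropy (marginal_X E Q) \<mu>)"
  proof -
    have "continuous_on K (\<lambda>Q. \<Sum>i\<in>UNIV. (\<lambda>x. x * ln (x / \<mu> $ i)) (marginal_X E Q $ i))"
    proof (rule continuous_on_sum)
      fix i
      show "continuous_on K (\<lambda>Q. (\<lambda>x. x * ln (x / \<mu> $ i)) (marginal_X E Q $ i))"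
      proof (rule continuous_on_compose2[OF continuous_on_entropy_term])
        show "0 < \<mu> $ i" using \<mu> by blast
        show "continuous_on K (\<lambda>Q. marginal_X E Q $ i)"
          unfolding marginal_X_def by (simp, intro continuous_intros)
        show "(\<lambda>Q. marginal_X E Q $ i) ` K \<subseteq> {0..}"
          by (auto simp: K marginal_X_def intro!: sum_nonneg)
      qed
    qed
    then show ?thesis by (simp add: rel_entropy_def)
  qed
  ultimately obtain Q where "Q \<in> K"
    and "\<forall>Q'\<in>K. rel_entropy (marginal_X E Q) \<mu> \<le> rel_entropy (marginal_X E Q') \<mu>"
    using continuous_attains_inf by blast
  then have "is_arg_min (\<lambda>\<mu>'. rel_entropy \<mu>' \<mu>)
    (\<lambda>\<mu>'. \<exists>Q\<in>edge_simplex E. marginal_X E Q = \<mu>' \<and> marginal_Y E Q = \<nu>) (marginal_X E Q)"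
    unfolding is_arg_min_def K_def by (auto simp: not_less)
  then show ?thesis
    unfolding mu_star_def arg_min_def
    by (rule someI[where P = "is_arg_min (\<lambda>\<mu>'. rel_entropy \<mu>' \<mu>)
      (\<lambda>\<mu>'. \<exists>Q\<in>edge_simplex E. marginal_X E Q = \<mu>' \<and> marginal_Y E Q = \<nu>)"])
qed

text \<open>
  The convex function \<open>x \<mapsto> x log (x / q)\<close> lies above its tangent at \<open>y\<close>, also at the point \<open>x = 0\<close>
  where its own slope is \<open>-\<infinity>\<close>.
\<close>

lemma entropy_term_tangent:
  fixes x y q :: real
  assumes "x \<ge> 0" "y > 0" "q > 0"
  shows "x * ln (x / q) \<ge> y * ln (y / q) + (ln (y / q) + 1) * (x - y)"
proof (cases "x = 0")
  case True
  then show ?thesis using assms by (simp add: algebra_simps)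
next
  case False
  then have x: "x > 0" using assms by simp
  have "ln (y / x) \<le> y / x - 1"
    using x assms by (intro ln_le_minus_one) auto
  then have "x * ln (y / x) \<le> x * (y / x - 1)"
    using x by (intro mult_left_mono) auto
  also have "\<dots> = y - x" using x by (simp add: field_simps)
  finally have "x * ln (y / x) \<le> y - x" .
  moreover have "ln (y / x) = ln (y / q) - ln (x / q)"
    using x assms by (simp add: ln_div)
  ultimately show ?thesis by (simp add: algebra_simps)
qed

text \<open>
  The first-order optimality condition. Moving mass \<open>e\<close> within column \<open>j\<close> from row \<open>a\<close> to row \<open>i\<close>
  keeps the column sums. The tangents are taken at the perturbed row sums, which are positive, so the
  argument covers a row \<open>i\<close> that receives no mass at all.
\<close>

lemma minimizer_feeds_lowest_ratio:
  fixes \<mu> :: "real ^ 'm" and \<nu> :: "real ^ 'n" and Q :: "real ^ 'n ^ 'm"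
  assumes \<mu>: "\<forall>i. \<mu> $ i > 0" and \<nu>: "\<nu> \<in> prob_simplex"
    and Q: "Q \<in> edge_simplex E" "marginal_Y E Q = \<nu>"
    and opt: "\<And>Q'. Q' \<in> edge_simplex E \<Longrightarrow> marginal_Y E Q' = \<nu> \<Longrightarrow>
      rel_entropy (marginal_X E Q) \<mu> \<le> rel_entropy (marginal_X E Q') \<mu>"
    and a: "Q $ a $ j > 0" and i: "(i, j) \<in> E"
  shows "marginal_X E Q $ a / \<mu> $ a \<le> marginal_X E Q $ i / \<mu> $ i"
proof (rule ccontr)
  define r where "r = marginal_X E Q"
  \<comment> \<open>Moving \<open>\<delta>\<close> shrinks the gap \<open>r\<^sub>a \<mu>\<^sub>i - r\<^sub>i \<mu>\<^sub>a\<close> to half its size, so the order of the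
    two ratios survives the perturbation.\<close>
  define \<delta> where "\<delta> = (r $ a * \<mu> $ i - r $ i * \<mu> $ a) / (2 * (\<mu> $ i + \<mu> $ a))"
  define e where "e = min (Q $ a $ j) \<delta>"
  have \<mu>ia: "\<mu> $ i > 0" "\<mu> $ a > 0" using \<mu> by auto
  assume "\<not> ?thesis"
  then have gap: "r $ a * \<mu> $ i - r $ i * \<mu> $ a > 0"
    using \<mu>ia by (simp add: r_def field_simps)
  then have \<delta>: "\<delta> > 0" using \<mu>ia by (simp add: \<delta>_def)
  then have e: "e > 0" "e \<le> Q $ a $ j" "e \<le> \<delta>" using a by (auto simp: e_def)
  have ai: "a \<noteq> i" using gap by auto
  have Qs: "\<And>i j. 0 \<le> Q $ i $ j" "\<And>i j. (i, j) \<notin> E \<Longrightarrow> Q $ i $ j = 0"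
    "\<And>j. (\<Sum>i\<in>UNIV. Q $ i $ j) = \<nu> $ j"
    using Q feasible_plan_iff[OF \<nu>, of Q E] by auto
  have r_nonneg: "r $ k \<ge> 0" for k
    using Qs by (simp add: r_def marginal_X_full[OF Q(1)] sum_nonneg)
  define d :: "'m \<Rightarrow> real" where "d k = (if k = i then e else 0) - (if k = a then e else 0)" for k
  define Q' :: "real ^ 'n ^ 'm" where "Q' = (\<chi> k l. Q $ k $ l + (if l = j then d k else 0))"
  have d_sum: "(\<Sum>k\<in>UNIV. d k) = 0"
    by (simp add: d_def sum_subtractf)
  have "\<forall>k l. 0 \<le> Q' $ k $ l"
    using Qs(1) e a by (auto simp: Q'_def d_def add_nonneg_nonneg less_imp_le)
  moreover have "\<forall>k l. (k, l) \<notin> E \<longrightarrow> Q' $ k $ l = 0"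
    using Qs(2) i a by (auto simp: Q'_def d_def)
  moreover have "(\<Sum>k\<in>UNIV. Q' $ k $ l) = \<nu> $ l" for l
    using Qs(3)[of l] d_sum by (cases "l = j") (simp_all add: Q'_def sum.distrib)
  ultimately have Q': "Q' \<in> edge_simplex E" "marginal_Y E Q' = \<nu>"
    using feasible_plan_iff[OF \<nu>, of Q' E] by auto
  have r': "marginal_X E Q' $ k = r $ k + d k" for k
    unfolding r_def marginal_X_full[OF Q(1)] marginal_X_full[OF Q'(1)]
    by (simp add: Q'_def sum.distrib)
  define L where "L k = ln ((r $ k + d k) / \<mu> $ k)" for k
  have "e * (\<mu> $ i + \<mu> $ a) \<le> \<delta> * (\<mu> $ i + \<mu> $ a)"
    using e \<mu>ia by (intro mult_right_mono) auto
  also have "\<dots> = (r $ a * \<mu> $ i - r $ i * \<mu> $ a) / 2"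
    using \<mu>ia by (simp add: \<delta>_def divide_simps)
  also have "\<dots> < r $ a * \<mu> $ i - r $ i * \<mu> $ a"
    using gap by (simp add: mult.commute)
  finally have "(r $ i + e) / \<mu> $ i < (r $ a - e) / \<mu> $ a"
    using \<mu>ia by (simp add: field_simps)
  moreover have "0 < (r $ i + e) / \<mu> $ i"
    using r_nonneg[of i] e \<mu>ia by (simp add: add_nonneg_pos)
  ultimately have ratio: "0 < (r $ i + d i) / \<mu> $ i"
    "(r $ i + d i) / \<mu> $ i < (r $ a + d a) / \<mu> $ a"
    using ai by (auto simp: d_def)
  then have L: "L i < L a"
    unfolding L_def by (simp only: ln_less_cancel_iff order.strict_trans)
  have pos: "r $ i + d i > 0" "r $ a + d a > 0"
    using ratio(1) order.strict_trans[OF ratio] \<mu>ia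
    by (simp_all only: zero_less_divide_iff) linarith+
  have tangent: "(r $ k + d k) * L k - (L k + 1) * d k \<le> r $ k * ln (r $ k / \<mu> $ k)" for k
  proof (cases "k = i \<or> k = a")
    case True
    then show ?thesis
      using entropy_term_tangent[of "r $ k" "r $ k + d k" "\<mu> $ k"] r_nonneg pos \<mu>
      by (auto simp: L_def)
  next
    case False
    then show ?thesis by (simp add: d_def L_def)
  qed
  have "rel_entropy (marginal_X E Q') \<mu> - (\<Sum>k\<in>UNIV. (L k + 1) * d k)
      = (\<Sum>k\<in>UNIV. (r $ k + d k) * L k - (L k + 1) * d k)"
    by (simp add: rel_entropy_def r' L_def sum_subtractf)
  also have "\<dots> \<le> rel_entropy r \<mu>"
    unfolding rel_entropy_def by (intro sum_mono tangent)
  also have "(\<Sum>k\<in>UNIV. (L k + 1) * d k)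
      = (\<Sum>k\<in>UNIV. (if k = i then (L i + 1) * e else 0) - (if k = a then (L a + 1) * e else 0))"
    by (intro sum.cong) (auto simp: d_def)
  also have "\<dots> = e * (L i - L a)"
    by (simp add: sum_subtractf algebra_simps)
  finally have "rel_entropy (marginal_X E Q') \<mu> \<le> rel_entropy r \<mu> - e * (L a - L i)"
    by (simp add: algebra_simps)
  also have "\<dots> < rel_entropy r \<mu>"
    using L e by simp
  finally show False
    using opt[OF Q'] by (simp add: r_def)
qed

section \<open>Optimality certificates\<close>

text \<open>
  The Karush-Kuhn-Tucker conditions of the problem defining \<open>\<mu>\<^sup>*(E)\<close>: \<open>Q\<close> is the plan, \<open>exp (- v)\<close> the
  density of its row sums with respect to \<open>\<mu>\<close>, and \<open>w\<close> the multiplier of the column constraints. The sign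
  conditions are symmetric in \<open>v\<close> and \<open>w\<close>.
\<close>

definition certificate ::
  "real ^ 'm \<Rightarrow> real ^ 'n \<Rightarrow> ('m \<times> 'n) set \<Rightarrow> real ^ 'm \<Rightarrow> real ^ 'n \<Rightarrow> real ^ 'n ^ 'm \<Rightarrow> bool" where
  "certificate \<mu> \<nu> E v w Q \<longleftrightarrow>
     (\<forall>i j. 0 \<le> Q $ i $ j) \<and>
     (\<forall>i j. Q $ i $ j > 0 \<longrightarrow> (i, j) \<in> E \<and> v $ i + w $ j = 0) \<and>
     (\<forall>i j. (i, j) \<in> E \<longrightarrow> v $ i + w $ j \<le> 0) \<and>
     (\<forall>i. (\<Sum>j\<in>UNIV. Q $ i $ j) = \<mu> $ i * exp (- v $ i)) \<and>
     (\<forall>j. (\<Sum>i\<in>UNIV. Q $ i $ j) = \<nu> $ j)"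

lemma ex_pos_summand:
  fixes h :: "'k::finite \<Rightarrow> real"
  assumes "(\<Sum>k\<in>UNIV. h k) > 0"
  shows "\<exists>k. h k > 0"
  using assms by (meson not_less sum_nonpos)

text \<open>
  In each column the optimal plan charges only rows with the lowest ratio, that is with the largest
  \<open>v\<close>. So any charged row \<open>src j\<close> of column \<open>j\<close> may serve to define the multiplier.
\<close>

lemma v_star_certificate:
  fixes \<mu> :: "real ^ 'm" and \<nu> :: "real ^ 'n"
  assumes \<mu>: "\<forall>i. \<mu> $ i > 0" and \<nu>: "\<nu> \<in> prob_simplex" "\<forall>j. \<nu> $ j > 0"
    and E: "no_isolated_vertex E"
  shows "\<exists>w Q. certificate \<mu> \<nu> E (v_star \<mu> \<nu> E) w Q"
proof -
  define r where "r = mu_star \<mu> \<nu> E"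
  define v where "v = v_star \<mu> \<nu> E"
  obtain Q where Q: "Q \<in> edge_simplex E" "marginal_Y E Q = \<nu>" and r: "marginal_X E Q = r"
    and opt: "\<And>Q'. Q' \<in> edge_simplex E \<Longrightarrow> marginal_Y E Q' = \<nu> \<Longrightarrow>
      rel_entropy (marginal_X E Q) \<mu> \<le> rel_entropy (marginal_X E Q') \<mu>"
    using entropy_minimizer_exists[OF \<mu> \<nu>(1) E]
    unfolding is_arg_min_def r_def by (auto simp: not_less)
  have lowest: "r $ a / \<mu> $ a \<le> r $ i / \<mu> $ i" if "Q $ a $ j > 0" "(i, j) \<in> E" for a i j
    using minimizer_feeds_lowest_ratio[OF \<mu> \<nu>(1) Q _ that] opt unfolding r by blast
  have Qs: "\<And>i j. 0 \<le> Q $ i $ j" "\<And>i j. (i, j) \<notin> E \<Longrightarrow> Q $ i $ j = 0"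
    "\<And>j. (\<Sum>i\<in>UNIV. Q $ i $ j) = \<nu> $ j"
    using Q feasible_plan_iff[OF \<nu>(1), of Q E] by auto
  have rows: "(\<Sum>j\<in>UNIV. Q $ i $ j) = r $ i" for i
    using marginal_X_full[OF Q(1)] r by simp
  have source: "\<exists>a. Q $ a $ j > 0" for j
    using ex_pos_summand[of "\<lambda>i. Q $ i $ j"] Qs(3) \<nu>(2) by simp
  have r_fed: "r $ a > 0" if "Q $ a $ j > 0" for a j
  proof -
    have "Q $ a $ j \<le> (\<Sum>j\<in>UNIV. Q $ a $ j)"
      using Qs(1) by (intro member_le_sum) auto
    then show ?thesis using that rows by simp
  qed
  \<comment> \<open>No row stays empty: its ratio is at least that of a charged row in a neighbouring column.\<close>
  have r_pos: "r $ i > 0" for i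
  proof -
    obtain j where j: "(i, j) \<in> E" using E by (auto simp: no_isolated_vertex_def)
    obtain a where a: "Q $ a $ j > 0" using source by blast
    have "0 < r $ a / \<mu> $ a" using r_fed[OF a] \<mu> by simp
    also have "\<dots> \<le> r $ i / \<mu> $ i" by (rule lowest[OF a j])
    finally show ?thesis using \<mu> by (metis zero_less_divide_iff less_asym)
  qed
  have v: "v $ i = ln (\<mu> $ i / r $ i)" for i
    by (simp add: v_def v_star_def r_def)
  have v_highest: "v $ i \<le> v $ a" if "Q $ a $ j > 0" "(i, j) \<in> E" for i a j
    using lowest[OF that] r_pos[of i] r_pos[of a] \<mu> by (simp add: v field_simps)
  obtain src where src: "Q $ src j $ j > 0" for j
    using source by metis
  define w where "w = (\<chi> j. - v $ src j)"
  have in_E: "(i, j) \<in> E" if "Q $ i $ j > 0" for i j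
    using Qs(2)[of i j] that by fastforce
  have le: "v $ i + w $ j \<le> 0" if "(i, j) \<in> E" for i j
    using v_highest[OF src that] by (simp add: w_def)
  moreover have "v $ i + w $ j = 0" if "Q $ i $ j > 0" for i j
    using v_highest[OF that in_E[OF src]] le[OF in_E[OF that]] by (simp add: w_def)
  moreover have "r $ i = \<mu> $ i * exp (- v $ i)" for i
    using r_pos[of i] \<mu>[rule_format, of i] by (simp add: v exp_minus)
  ultimately have "certificate \<mu> \<nu> E v w Q"
    using Qs rows in_E by (simp add: certificate_def)
  then show ?thesis unfolding v_def by blast
qed

text \<open>
  On the support of \<open>Q\<close> one has \<open>exp v\<^sub>i = exp (- w\<^sub>j)\<close>. Hence the factor \<open>exp v\<^sub>i\<close> turns the row sums
  \<open>\<mu>\<^sub>i exp (- v\<^sub>i)\<close> into \<open>\<mu>\<^sub>i\<close>, and at the same time the column sums \<open>\<nu>\<^sub>j\<close> into \<open>\<nu>\<^sub>j exp (- w\<^sub>j)\<close>.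
\<close>

lemma certificate_rescale:
  fixes \<mu> :: "real ^ 'm" and \<nu> :: "real ^ 'n"
  assumes "certificate \<mu> \<nu> E v w Q"
  shows "certificate \<nu> \<mu> (E\<inverse>) w v (\<chi> j i. Q $ i $ j * exp (v $ i))"
proof -
  have rw: "Q $ i $ j * exp (v $ i) = Q $ i $ j * exp (- w $ j)" for i j
  proof (cases "Q $ i $ j > 0")
    case True
    then have "v $ i = - w $ j" using assms by (fastforce simp: certificate_def)
    then show ?thesis by simp
  next
    case False
    then have "Q $ i $ j = 0" using assms by (auto simp: certificate_def intro: antisym)
    then show ?thesis by simp
  qed
  have "(\<Sum>i\<in>UNIV. Q $ i $ j * exp (v $ i)) = \<nu> $ j * exp (- w $ j)" for j
    unfolding rw using assms by (simp add: certificate_def flip: sum_distrib_right)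
  moreover have "(\<Sum>j\<in>UNIV. Q $ i $ j * exp (v $ i)) = \<mu> $ i" for i
    using assms by (simp add: certificate_def exp_minus flip: sum_distrib_right)
  ultimately show ?thesis
    using assms by (auto simp: certificate_def zero_less_mult_iff add.commute)
qed

text \<open>
  \<open>\<Sum>\<^sub>j \<nu>\<^sub>j w\<^sub>j\<close> is the optimal value \<open>H(\<mu>\<^sup>* | \<mu>)\<close>, as \<open>\<nu>\<close> is the column marginal of \<open>Q\<close> and
  \<open>w\<^sub>j = - v\<^sub>i\<close> on its support; if \<open>Q\<close> is admissible for \<open>E'\<close>, the optimal value for \<open>E'\<close> cannot be larger.
  Working with the multipliers makes this a comparison of exponentials with their tangents:
  testing the second certificate with \<open>Q\<close> bounds the difference of the two values by
  \<open>\<Sum>\<^sub>i \<mu>\<^sub>i exp (- v\<^sub>i) (v\<^sub>i - v'\<^sub>i)\<close>, which is nonpositive by \<open>1 + x \<le> exp x\<close> and because both plans have the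
  total mass of \<open>\<nu>\<close>. Equality in \<open>1 + x \<le> exp x\<close> only at \<open>0\<close> gives \<open>v' = v\<close>.
\<close>

lemma certificate_dual_value_mono:
  fixes \<mu> :: "real ^ 'm" and \<nu> :: "real ^ 'n"
  assumes \<mu>: "\<forall>i. \<mu> $ i > 0" and \<nu>: "\<forall>j. \<nu> $ j > 0"
    and 1: "certificate \<mu> \<nu> E v w Q" and 2: "certificate \<mu> \<nu> E' v' w' Q'"
    and supp: "\<And>i j. Q $ i $ j > 0 \<Longrightarrow> (i, j) \<in> E'"
  shows "(\<Sum>j\<in>UNIV. \<nu> $ j * w' $ j) \<le> (\<Sum>j\<in>UNIV. \<nu> $ j * w $ j)" (is "?\<Phi>' \<le> ?\<Phi>")
    and "(\<Sum>j\<in>UNIV. \<nu> $ j * w' $ j) = (\<Sum>j\<in>UNIV. \<nu> $ j * w $ j) \<Longrightarrow> v' = v \<and> w' = w"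
proof -
  note c = 1[unfolded certificate_def] and c' = 2[unfolded certificate_def]
  have mass: "(\<Sum>i\<in>UNIV. \<mu> $ i * exp (- v $ i)) = (\<Sum>j\<in>UNIV. \<nu> $ j)"
    if "certificate \<mu> \<nu> E v w Q" for E v w Q
    using that sum.swap[of "\<lambda>i j. Q $ i $ j" UNIV UNIV] by (simp add: certificate_def)
  have "(\<Sum>j\<in>UNIV. \<nu> $ j * (w' $ j - w $ j)) = (\<Sum>j\<in>UNIV. \<Sum>i\<in>UNIV. Q $ i $ j * (w' $ j - w $ j))"
    using c by (simp flip: sum_distrib_right)
  also have "\<dots> \<le> (\<Sum>j\<in>UNIV. \<Sum>i\<in>UNIV. Q $ i $ j * (v $ i - v' $ i))"
  proof (intro sum_mono)
    fix i j
    show "Q $ i $ j * (w' $ j - w $ j) \<le> Q $ i $ j * (v $ i - v' $ i)"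
    proof (cases "Q $ i $ j > 0")
      case True
      then have "v $ i + w $ j = 0" "v' $ i + w' $ j \<le> 0"
        using c c' supp by auto
      then show ?thesis using True by (intro mult_left_mono) auto
    next
      case False
      then have "Q $ i $ j = 0" using c by (auto intro: antisym)
      then show ?thesis by simp
    qed
  qed
  also have "\<dots> = (\<Sum>i\<in>UNIV. \<Sum>j\<in>UNIV. Q $ i $ j * (v $ i - v' $ i))"
    by (rule sum.swap)
  also have "\<dots> = (\<Sum>i\<in>UNIV. \<mu> $ i * exp (- v $ i) * (v $ i - v' $ i))"
    using c by (simp flip: sum_distrib_right)
  finally have step1: "?\<Phi>' - ?\<Phi> \<le> (\<Sum>i\<in>UNIV. \<mu> $ i * exp (- v $ i) * (v $ i - v' $ i))"
    by (simp add: right_diff_distrib sum_subtractf)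
  \<comment> \<open>The gaps in \<open>1 + x \<le> exp x\<close>; they sum to the relative entropy of \<open>\<mu> exp (- v)\<close> with respect
    to \<open>\<mu> exp (- v')\<close>.\<close>
  define gap where
    "gap i = \<mu> $ i * exp (- v $ i) * (exp (v $ i - v' $ i) - 1 - (v $ i - v' $ i))" for i
  have gap_nonneg: "gap i \<ge> 0" for i
    using exp_ge_add_one_self[of "v $ i - v' $ i"] \<mu>[rule_format, of i]
    unfolding gap_def by (intro mult_nonneg_nonneg exp_ge_zero) linarith+
  have "(\<Sum>i\<in>UNIV. \<mu> $ i * exp (- v $ i) * (v $ i - v' $ i)) + (\<Sum>i\<in>UNIV. gap i)
      = (\<Sum>i\<in>UNIV. \<mu> $ i * exp (- v' $ i)) - (\<Sum>i\<in>UNIV. \<mu> $ i * exp (- v $ i))"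
    unfolding gap_def sum.distrib[symmetric] sum_subtractf[symmetric]
    by (intro sum.cong) (auto simp: algebra_simps simp flip: exp_add)
  also have "\<dots> = 0" using mass[OF 1] mass[OF 2] by simp
  finally have step2: "?\<Phi>' - ?\<Phi> \<le> - (\<Sum>i\<in>UNIV. gap i)"
    using step1 by linarith
  then show "?\<Phi>' \<le> ?\<Phi>"
    using sum_nonneg[of UNIV gap] gap_nonneg by simp
  assume eq: "?\<Phi>' = ?\<Phi>"
  then have "(\<Sum>i\<in>UNIV. gap i) = 0"
    using step2 sum_nonneg[of UNIV gap] gap_nonneg by simp
  then have gap0: "gap i = 0" for i
    using gap_nonneg by (simp add: sum_nonneg_eq_0_iff)
  have v_eq: "v' $ i = v $ i" for i
  proof (rule ccontr)
    assume neq: "v' $ i \<noteq> v $ i"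
    have "exp (v $ i - v' $ i) = 1 + (v $ i - v' $ i)"
      using gap0[of i] \<mu> by (force simp: gap_def less_le)
    then have "ln (exp (v $ i - v' $ i)) = exp (v $ i - v' $ i) - 1"
      unfolding ln_exp by linarith
    then have "exp (v $ i - v' $ i) = 1" by (intro ln_eq_minus_one) auto
    then show False using neq by simp
  qed
  have w_le: "w' $ j \<le> w $ j" for j
  proof -
    have "\<exists>i. Q $ i $ j > 0" using c \<nu> by (intro ex_pos_summand) auto
    then obtain i where "Q $ i $ j > 0" by blast
    then have "v $ i + w $ j = 0" "v' $ i + w' $ j \<le> 0"
      using c c' supp by auto
    then show ?thesis using v_eq[of i] by linarith
  qed
  have "(\<Sum>j\<in>UNIV. \<nu> $ j * (w $ j - w' $ j)) = 0"
    using eq by (simp add: right_diff_distrib sum_subtractf)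
  then have "\<nu> $ j * (w $ j - w' $ j) = 0" for j
    using w_le \<nu> by (subst (asm) sum_nonneg_eq_0_iff) (auto simp: less_imp_le)
  then have "w' $ j = w $ j" for j
    using \<nu> by (metis eq_iff_diff_eq_0 less_irrefl mult_eq_0_iff)
  then show "v' = v \<and> w' = w"
    using v_eq by (simp add: vec_eq_iff)
qed

lemma certificate_unique:
  fixes \<mu> :: "real ^ 'm" and \<nu> :: "real ^ 'n"
  assumes \<mu>: "\<forall>i. \<mu> $ i > 0" and \<nu>: "\<forall>j. \<nu> $ j > 0"
    and 1: "certificate \<mu> \<nu> E v w Q" and 2: "certificate \<mu> \<nu> E v' w' Q'"
  shows "v' = v \<and> w' = w"
proof -
  have "Q $ i $ j > 0 \<Longrightarrow> (i, j) \<in> E" "Q' $ i $ j > 0 \<Longrightarrow> (i, j) \<in> E" for i j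
    using 1 2 by (auto simp: certificate_def)
  note mono = certificate_dual_value_mono[OF \<mu> \<nu> 1 2 this(1)]
    certificate_dual_value_mono[OF \<mu> \<nu> 2 1 this(2)]
  show ?thesis using mono(1,2,3) by force
qed

lemma nu_star_eq_mu_star:
  fixes \<mu> :: "real ^ 'm" and \<nu> :: "real ^ 'n"
  shows "nu_star \<mu> \<nu> E = mu_star \<nu> \<mu> (E\<inverse>)"
proof -
  have simplex: "transpose P \<in> edge_simplex (F\<inverse>)" if "P \<in> edge_simplex F"
    for P :: "real ^ 'b ^ 'a" and F
  proof -
    have "(\<Sum>(j, i)\<in>F\<inverse>. transpose P $ j $ i) = (\<Sum>(i, j)\<in>F. P $ i $ j)"
      by (rule sum.reindex_bij_witness[of _ prod.swap prod.swap]) (auto simp: transpose_def)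
    moreover have "(\<Sum>(i, j)\<in>F. P $ i $ j) = 1"
      using that by (simp only: edge_simplex_def mem_Collect_eq)
    ultimately have "(\<Sum>(j, i)\<in>F\<inverse>. transpose P $ j $ i) = 1"
      by (rule trans)
    moreover have "\<forall>j i. 0 \<le> transpose P $ j $ i"
      and "\<forall>j i. (j, i) \<notin> F\<inverse> \<longrightarrow> transpose P $ j $ i = 0"
      using that by (auto simp: edge_simplex_def transpose_def)
    ultimately show ?thesis
      unfolding edge_simplex_def by blast
  qed
  have marginals: "marginal_X (F\<inverse>) (transpose P) = marginal_Y F P"
    "marginal_Y (F\<inverse>) (transpose P) = marginal_X F P" for P :: "real ^ 'b ^ 'a" and F
    by (simp_all add: marginal_X_def marginal_Y_def transpose_def)
  have "(\<exists>P\<in>edge_simplex E. marginal_X E P = \<mu> \<and> marginal_Y E P = \<nu>') \<longleftrightarrow>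
    (\<exists>Q\<in>edge_simplex (E\<inverse>). marginal_X (E\<inverse>) Q = \<nu>' \<and> marginal_Y (E\<inverse>) Q = \<mu>)" for \<nu>'
    using simplex[of _ E] simplex[of _ "E\<inverse>"] marginals[of E] marginals[of "E\<inverse>"]
    by (metis converse_converse)
  then show ?thesis by (simp add: nu_star_def mu_star_def)
qed

text \<open>
  \<open>v\<^sup>*(E)\<close> and \<open>w\<^sup>*(E)\<close> come from two separate minimizations. Each one has a certificate with some partner,
  the second one after exchanging the roles of rows and columns; uniqueness identifies the two
  certificates, so \<open>v\<^sup>*(E)\<close> and \<open>w\<^sup>*(E)\<close> are each other's partners.
\<close>

lemma star_certificate:
  fixes \<mu> :: "real ^ 'm" and \<nu> :: "real ^ 'n"
  assumes \<mu>: "\<mu> \<in> prob_simplex" "\<forall>i. \<mu> $ i > 0" and \<nu>: "\<nu> \<in> prob_simplex" "\<forall>j. \<nu> $ j > 0"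
    and E: "no_isolated_vertex E"
  shows "\<exists>Q. certificate \<mu> \<nu> E (v_star \<mu> \<nu> E) (w_star \<mu> \<nu> E) Q"
proof -
  obtain w Q where 1: "certificate \<mu> \<nu> E (v_star \<mu> \<nu> E) w Q"
    using v_star_certificate[OF \<mu>(2) \<nu> E] by blast
  have "no_isolated_vertex (E\<inverse>)" using E by (auto simp: no_isolated_vertex_def)
  then obtain v P where "certificate \<nu> \<mu> (E\<inverse>) (v_star \<nu> \<mu> (E\<inverse>)) v P"
    using v_star_certificate[OF \<nu>(2) \<mu>] by blast
  from certificate_rescale[OF this]
  have "\<exists>Q'. certificate \<mu> \<nu> E v (w_star \<mu> \<nu> E) Q'"
    by (auto simp: w_star_def v_star_def nu_star_eq_mu_star)
  then show ?thesis
    using certificate_unique[OF \<mu>(2) \<nu>(2) 1] 1 by blast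
qed

text \<open>Every row and every column of the plan carries positive mass.\<close>

lemma certificate_support_no_isolated_vertex:
  fixes \<mu> :: "real ^ 'm" and \<nu> :: "real ^ 'n"
  assumes \<mu>: "\<forall>i. \<mu> $ i > 0" and \<nu>: "\<forall>j. \<nu> $ j > 0"
    and cert: "certificate \<mu> \<nu> E v w Q"
  shows "no_isolated_vertex {(i, j). Q $ i $ j > 0}"
proof -
  have "\<exists>j. Q $ i $ j > 0" for i
    using cert \<mu> by (intro ex_pos_summand) (auto simp: certificate_def)
  moreover have "\<exists>i. Q $ i $ j > 0" for j
    using cert \<nu> by (intro ex_pos_summand) (auto simp: certificate_def)
  ultimately show ?thesis by (auto simp: no_isolated_vertex_def)
qed

section \<open>One phase of the dynamics\<close>

text \<open>
  The conclusion reaches the endpoint \<open>T\<close>, where no derivative is prescribed, by continuity of \<open>h\<close>.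
\<close>

lemma affine_from_constant_derivative:
  fixes h :: "real \<Rightarrow> 'a::banach" and t :: real and T :: ereal
  defines "J \<equiv> {s. t \<le> s \<and> ereal s < T}"
  assumes cont: "continuous_on {t..} h"
    and deriv: "\<And>s. s \<in> J \<Longrightarrow> (h has_vector_derivative v) (at s within J)"
    and s: "t \<le> s" "ereal s \<le> T"
  shows "h s = h t + (s - t) *\<^sub>R v"
proof -
  define k where "k x = h x - (x - t) *\<^sub>R v" for x
  have "k s = h t"
  proof (rule has_derivative_zero_unique_strong_interval[of "{t, s}" t s])
    show "continuous_on {t..s} k"
      unfolding k_def by (intro continuous_intros continuous_on_subset[OF cont]) auto
    fix x assume x: "x \<in> {t..s} - {t, s}"
    then have "{t<..<s} \<subseteq> J" "x \<in> J"
      using s by (auto simp: J_def intro: less_le_trans[of _ "ereal s"])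
    then have "(h has_vector_derivative v) (at x within {t<..<s})"
      using deriv has_vector_derivative_within_subset by blast
    then have "(h has_vector_derivative v) (at x)"
      using x at_within_open[of x "{t<..<s}"] by simp
    moreover have "((\<lambda>x. (x - t) *\<^sub>R v) has_vector_derivative v) (at x)"
      unfolding has_vector_derivative_def by (auto intro!: derivative_eq_intros)
    ultimately have "(k has_vector_derivative v - v) (at x)"
      unfolding k_def by (rule has_vector_derivative_diff)
    then show "(k has_derivative (\<lambda>h. 0)) (at x within {t..s})"
      by (simp add: has_vector_derivative_def has_derivative_at_withinI)
  qed (use s in \<open>auto simp: k_def\<close>)
  then show ?thesis by (simp add: k_def algebra_simps)
qed

text \<open>The supremum is a maximum over finitely many edges, or \<open>-\<infinity>\<close> if \<open>E\<close> contains all edges.\<close>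

lemma SUP_edges_nonneg_iff:
  fixes h :: "'m::finite \<Rightarrow> 'n::finite \<Rightarrow> real"
  shows "(SUP (i, j)\<in>- E. ereal (h i j)) \<ge> 0 \<longleftrightarrow> (\<exists>(i, j)\<in>- E. h i j \<ge> 0)"
proof (cases "- E = {}")
  case True
  show ?thesis unfolding True by (simp add: bot_ereal_def)
next
  case False
  then have "(SUP (i, j)\<in>- E. ereal (h i j)) = Max ((\<lambda>(i, j). ereal (h i j)) ` (- E))"
    by (intro Max_Sup[symmetric]) auto
  moreover have "0 \<le> Max ((\<lambda>(i, j). ereal (h i j)) ` (- E)) \<longleftrightarrow> (\<exists>(i, j)\<in>- E. ereal (h i j) \<ge> 0)"
    using False by (subst Max_ge_iff) (auto simp: case_prod_beta)
  ultimately show ?thesis by simp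
qed

lemma excess_neg_before_next_time:
  assumes "t \<le> s" "ereal s < next_time \<mu> \<nu> C f g t E" "(i, j) \<notin> E"
  shows "excess \<mu> \<nu> C (f t) (g t) E (s - t) i j < 0"
proof (rule ccontr)
  assume "\<not> ?thesis"
  then have "\<exists>(i, j)\<in>- E. excess \<mu> \<nu> C (f t) (g t) E (s - t) i j \<ge> 0"
    using assms by (intro bexI[of _ "(i, j)"]) auto
  then have "ereal s \<in> ereal ` {s. s \<ge> t \<and>
      (SUP (i, j)\<in>- E. ereal (excess \<mu> \<nu> C (f t) (g t) E (s - t) i j)) \<ge> 0}"
    using assms unfolding SUP_edges_nonneg_iff by blast
  then have "next_time \<mu> \<nu> C f g t E \<le> ereal s"
    unfolding next_time_def by (rule Inf_lower)
  then show False using assms by simp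
qed

text \<open>
  The infimum of a nonempty closed set of times is a member of it, so at the switching time some
  constraint outside \<open>E\<close> has indeed become tight.
\<close>

lemma next_time_attained:
  assumes "next_time \<mu> \<nu> C f g t E < \<infinity>"
  obtains T i j where "next_time \<mu> \<nu> C f g t E = ereal T" "t \<le> T" "(i, j) \<notin> E"
    "excess \<mu> \<nu> C (f t) (g t) E (T - t) i j \<ge> 0"
proof -
  define S where "S = {s. s \<ge> t \<and> (\<exists>(i, j)\<in>- E. excess \<mu> \<nu> C (f t) (g t) E (s - t) i j \<ge> 0)}"
  have nt: "next_time \<mu> \<nu> C f g t E = Inf (ereal ` S)"
    unfolding next_time_def S_def SUP_edges_nonneg_iff ..
  have "S = (\<Union>(i, j)\<in>- E. {s. t \<le> s \<and> 0 \<le> excess \<mu> \<nu> C (f t) (g t) E (s - t) i j})"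
    by (auto simp: S_def)
  moreover have "closed \<dots>"
    unfolding excess_def
    by (intro closed_UN) (auto intro!: closed_Collect_conj closed_Collect_le continuous_intros)
  ultimately have "closed S" by simp
  moreover have "S \<noteq> {}" using assms by (auto simp: nt top_ereal_def)
  moreover have "bdd_below S" by (auto simp: S_def intro!: bdd_belowI[of _ t])
  ultimately have T: "Inf S \<in> S" by (intro closed_contains_Inf)
  have "Inf (ereal ` S) = ereal (Inf S)"
  proof (rule antisym)
    show "Inf (ereal ` S) \<le> ereal (Inf S)" using T by (intro Inf_lower) auto
    show "ereal (Inf S) \<le> Inf (ereal ` S)"
      using \<open>bdd_below S\<close> by (auto intro!: Inf_greatest cInf_lower)
  qed
  then show thesis using T that[of "Inf S"] nt by (auto simp: S_def)
qed

locale cold_dynamics =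
  fixes \<mu> :: "real ^ 'm" and \<nu> :: "real ^ 'n" and C :: "real ^ 'n ^ 'm"
    and f :: "real \<Rightarrow> real ^ 'm" and g :: "real \<Rightarrow> real ^ 'n"
  assumes \<mu>: "\<mu> \<in> prob_simplex" "\<forall>i. \<mu> $ i > 0"
    and \<nu>: "\<nu> \<in> prob_simplex" "\<forall>j. \<nu> $ j > 0"
    and start: "(f 0, g 0) \<in> pareto_frontier C"
    and dynamics: "cold_sinkhorn \<mu> \<nu> C (f 0) (g 0) f g"
begin

lemma phase_affine:
  assumes "phase \<mu> \<nu> C f g l = Some (t, E)" "0 \<le> t"
    and "t \<le> s" "ereal s \<le> next_time \<mu> \<nu> C f g t E"
  shows "f s = f t + (s - t) *\<^sub>R v_star \<mu> \<nu> E" "g s = g t + (s - t) *\<^sub>R w_star \<mu> \<nu> E"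
proof -
  have "continuous_on {t..} f" "continuous_on {t..} g"
    using dynamics assms(2) by (auto simp: cold_sinkhorn_def intro: continuous_on_subset)
  then show "f s = f t + (s - t) *\<^sub>R v_star \<mu> \<nu> E" "g s = g t + (s - t) *\<^sub>R w_star \<mu> \<nu> E"
    using dynamics assms
    by (auto simp: cold_sinkhorn_def Let_def intro!: affine_from_constant_derivative)
qed

lemma phase_excess:
  assumes "phase \<mu> \<nu> C f g l = Some (t, E)" "0 \<le> t"
    and "t \<le> s" "ereal s \<le> next_time \<mu> \<nu> C f g t E"
  shows "excess \<mu> \<nu> C (f t) (g t) E (s - t) i j = f s $ i + g s $ j - C $ i $ j"
  unfolding phase_affine[OF assms] by (simp add: excess_def algebra_simps)

text \<open>
  Edges in \<open>E\<close> start at excess zero and move with velocity \<open>v\<^sub>i + w\<^sub>j \<le> 0\<close>; edges outside \<open>E\<close> have negative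
  excess before the switching time, hence nonpositive excess at it. The edges in the support of the
  plan have velocity zero and stay tight. The switching time itself is included, so that
  the next phase again starts on the frontier, with at least those tight edges.
\<close>

lemma pareto_through_phase:
  assumes ph: "phase \<mu> \<nu> C f g l = Some (t, E)" "0 \<le> t"
    and pareto: "(f t, g t) \<in> pareto_frontier C" and E: "E = tight_edges C (f t) (g t)"
    and s: "t \<le> s" "ereal s \<le> next_time \<mu> \<nu> C f g t E"
    and cert: "certificate \<mu> \<nu> E (v_star \<mu> \<nu> E) (w_star \<mu> \<nu> E) Q"
  shows "(f s, g s) \<in> pareto_frontier C"
    and "{(i, j). Q $ i $ j > 0} \<subseteq> tight_edges C (f s) (g s)"
proof -
  define x where "x s i j = excess \<mu> \<nu> C (f t) (g t) E (s - t) i j" for s i j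
  have feas0: "f t $ i + g t $ j \<le> C $ i $ j" for i j
    using pareto by (auto simp: pareto_frontier_def dual_polytope_def)
  have x_le: "x s i j \<le> 0" for i j
  proof (cases "(i, j) \<in> E")
    case True
    then have "f t $ i + g t $ j = C $ i $ j" by (simp add: E tight_edges_def)
    moreover have "v_star \<mu> \<nu> E $ i + w_star \<mu> \<nu> E $ j \<le> 0"
      using True cert by (auto simp: certificate_def)
    ultimately show ?thesis
      using s by (simp add: x_def excess_def mult_nonneg_nonpos)
  next
    case False
    show ?thesis
    proof (cases "s = t")
      case True
      then show ?thesis using feas0[of i j] by (simp add: x_def excess_def)
    next
      case neq: False
      have "x u i j \<le> 0" if "u \<in> {t<..<s}" for u
      proof -
        have "ereal u < next_time \<mu> \<nu> C f g t E"
          using that s by (auto intro: less_le_trans[of _ "ereal s"])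
        then show ?thesis
          unfolding x_def using that False by (intro less_imp_le excess_neg_before_next_time) auto
      qed
      moreover have "continuous_on (closure {t<..<s}) (\<lambda>u. x u i j)"
        unfolding x_def excess_def by (intro continuous_intros)
      ultimately show ?thesis
        using neq s continuous_le_on_closure[of "{t<..<s}" "\<lambda>u. x u i j" s 0] by auto
    qed
  qed
  have ex: "x s i j = f s $ i + g s $ j - C $ i $ j" for i j
    unfolding x_def by (rule phase_excess[OF ph s])
  show sub: "{(i, j). Q $ i $ j > 0} \<subseteq> tight_edges C (f s) (g s)"
  proof clarify
    fix i j assume "Q $ i $ j > 0"
    then have "(i, j) \<in> E" "v_star \<mu> \<nu> E $ i + w_star \<mu> \<nu> E $ j = 0"
      using cert by (auto simp: certificate_def)
    then have "x s i j = 0" by (simp add: x_def excess_def E tight_edges_def)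
    then show "(i, j) \<in> tight_edges C (f s) (g s)" by (simp add: ex tight_edges_def)
  qed
  have "no_isolated_vertex (tight_edges C (f s) (g s))"
    using certificate_support_no_isolated_vertex[OF \<mu>(2) \<nu>(2) cert] sub
    unfolding no_isolated_vertex_def by blast
  moreover have "(f s, g s) \<in> dual_polytope C"
    using x_le ex by (auto simp: dual_polytope_def)
  ultimately show "(f s, g s) \<in> pareto_frontier C" by (simp add: pareto_frontier_iff)
qed

lemma obtain_certificate:
  assumes "(f t, g t) \<in> pareto_frontier C" "E = tight_edges C (f t) (g t)"
  obtains Q where "certificate \<mu> \<nu> E (v_star \<mu> \<nu> E) (w_star \<mu> \<nu> E) Q"
  using star_certificate[OF \<mu> \<nu>, of E] assms by (auto simp: pareto_frontier_iff)

section \<open>The switching times\<close>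

lemma phase_SucE:
  assumes "phase \<mu> \<nu> C f g (Suc l) = Some (t', E')"
  obtains t E where "phase \<mu> \<nu> C f g l = Some (t, E)" "next_time \<mu> \<nu> C f g t E < \<infinity>"
    "t' = real_of_ereal (next_time \<mu> \<nu> C f g t E)"
    "E' = {(i, j). excess \<mu> \<nu> C (f t) (g t) E (t' - t) i j = 0}"
  using assms by (auto simp: Let_def split: option.splits if_splits)

lemma phase_invariant:
  assumes "phase \<mu> \<nu> C f g l = Some (t, E)"
  shows "0 \<le> t \<and> (f t, g t) \<in> pareto_frontier C \<and> E = tight_edges C (f t) (g t)"
  using assms
proof (induction l arbitrary: t E)
  case 0
  then show ?case using start by (auto simp: tight_edges_def)
next
  case (Suc l t' E')
  then obtain t E where ph: "phase \<mu> \<nu> C f g l = Some (t, E)"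
    and fin: "next_time \<mu> \<nu> C f g t E < \<infinity>"
    and t': "t' = real_of_ereal (next_time \<mu> \<nu> C f g t E)"
    and E': "E' = {(i, j). excess \<mu> \<nu> C (f t) (g t) E (t' - t) i j = 0}"
    using phase_SucE by blast
  note IH = Suc.IH[OF ph]
  have nt: "next_time \<mu> \<nu> C f g t E = ereal t'" "t \<le> t'"
    using next_time_attained[OF fin] t' by (metis real_of_ereal.simps(1))+
  obtain Q where Q: "certificate \<mu> \<nu> E (v_star \<mu> \<nu> E) (w_star \<mu> \<nu> E) Q"
    using IH obtain_certificate by blast
  have "(f t', g t') \<in> pareto_frontier C"
    using pareto_through_phase(1)[OF ph _ _ _ _ _ Q, of t'] IH nt by simp
  moreover have "E' = tight_edges C (f t') (g t')"
    using phase_excess[OF ph, of t'] IH nt by (auto simp: E' tight_edges_def)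
  ultimately show ?case using IH nt by simp
qed

text \<open>
  The old plan is admissible for the new edge set, so the value does not increase. If it were
  unchanged, both velocities would be; but the edge \<open>(i, j)\<close> that triggers the switch has
  positive velocity before it and nonpositive velocity after it.
\<close>

lemma phase_dual_value_decreases:
  assumes "phase \<mu> \<nu> C f g (Suc l) = Some (t', E')" "phase \<mu> \<nu> C f g l = Some (t, E)"
  shows "(\<Sum>j\<in>UNIV. \<nu> $ j * w_star \<mu> \<nu> E' $ j) < (\<Sum>j\<in>UNIV. \<nu> $ j * w_star \<mu> \<nu> E $ j)"
proof -
  have fin: "next_time \<mu> \<nu> C f g t E < \<infinity>" and t': "t' = real_of_ereal (next_time \<mu> \<nu> C f g t E)"
    using phase_SucE[OF assms(1)] assms(2) by auto
  note inv = phase_invariant[OF assms(2)] and inv' = phase_invariant[OF assms(1)]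
  obtain i j where nt: "next_time \<mu> \<nu> C f g t E = ereal t'" "t \<le> t'"
    and ij: "(i, j) \<notin> E" "excess \<mu> \<nu> C (f t) (g t) E (t' - t) i j \<ge> 0"
    using next_time_attained[OF fin] t' by (metis real_of_ereal.simps(1))
  obtain Q where Q: "certificate \<mu> \<nu> E (v_star \<mu> \<nu> E) (w_star \<mu> \<nu> E) Q"
    using inv obtain_certificate by blast
  obtain Q' where Q': "certificate \<mu> \<nu> E' (v_star \<mu> \<nu> E') (w_star \<mu> \<nu> E') Q'"
    using inv' obtain_certificate by blast
  have "(k, l) \<in> E'" if "Q $ k $ l > 0" for k l
    using pareto_through_phase(2)[OF assms(2) _ _ _ _ _ Q, of t'] inv inv' nt that by auto
  note mono = certificate_dual_value_mono[OF \<mu>(2) \<nu>(2) Q Q' this]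
  have "f t' $ i + g t' $ j - C $ i $ j \<ge> 0"
    using ij(2) phase_excess[OF assms(2), of t'] inv nt by simp
  moreover have "f t' $ i + g t' $ j \<le> C $ i $ j"
    using inv' by (auto simp: pareto_frontier_def dual_polytope_def)
  ultimately have "(i, j) \<in> E'" using inv' by (simp add: tight_edges_def)
  then have "v_star \<mu> \<nu> E' $ i + w_star \<mu> \<nu> E' $ j \<le> 0"
    using Q' by (auto simp: certificate_def)
  moreover have "v_star \<mu> \<nu> E $ i + w_star \<mu> \<nu> E $ j > 0"
  proof -
    have "f t $ i + g t $ j < C $ i $ j"
      using inv ij(1) by (fastforce simp: pareto_frontier_def dual_polytope_def tight_edges_def
          order_less_le)
    then have "(t' - t) * (v_star \<mu> \<nu> E $ i + w_star \<mu> \<nu> E $ j) > 0"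
      using ij(2) by (simp add: excess_def)
    then show ?thesis using nt(2) by (simp add: zero_less_mult_iff)
  qed
  ultimately have "\<not> (v_star \<mu> \<nu> E' = v_star \<mu> \<nu> E \<and> w_star \<mu> \<nu> E' = w_star \<mu> \<nu> E)"
    by auto
  then show ?thesis using mono by (meson order_le_less)
qed

lemma finitely_many_phases: "\<exists>l. phase \<mu> \<nu> C f g l = None"
proof (rule ccontr)
  assume "\<not> ?thesis"
  then have "\<forall>l. \<exists>q. phase \<mu> \<nu> C f g l = Some q" by auto
  then obtain p where p: "\<And>l. phase \<mu> \<nu> C f g l = Some (p l)" by metis
  define F where "F l = (\<Sum>j\<in>UNIV. \<nu> $ j * w_star \<mu> \<nu> (snd (p l)) $ j)" for l
  have "F (Suc l) < F l" for l
  proof -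
    obtain t E where pl: "p l = (t, E)" by fastforce
    obtain t' E' where pSl: "p (Suc l) = (t', E')" by fastforce
    show ?thesis
      using phase_dual_value_decreases[OF p[of "Suc l", unfolded pSl] p[of l, unfolded pl]]
      unfolding F_def pl pSl snd_conv .
  qed
  then have "strict_mono (\<lambda>l. - F l)" by (intro strict_monoI_Suc) simp
  then have "inj (\<lambda>l. - F l)" by (rule strict_mono_imp_inj_on)
  then have "inj (\<lambda>l. snd (p l))" unfolding F_def by (auto simp: inj_def)
  then show False
    using finite_imageD[of "\<lambda>l. snd (p l)" UNIV] by simp
qed

text \<open>
  As there are finitely many phases, some phase has started by time \<open>s\<close> while its successor has not.
\<close>

lemma covering_phase:
  assumes "0 \<le> s"
  obtains l t E where "phase \<mu> \<nu> C f g l = Some (t, E)" "t \<le> s"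
    "ereal s < next_time \<mu> \<nu> C f g t E"
proof -
  define reached where
    "reached l \<longleftrightarrow> (\<exists>t E. phase \<mu> \<nu> C f g l = Some (t, E) \<and> t \<le> s)" for l
  obtain M where M: "phase \<mu> \<nu> C f g M = None" using finitely_many_phases by blast
  have "\<not> reached M" by (simp add: M reached_def)
  moreover have "reached 0" using assms by (simp add: reached_def)
  ultimately obtain l where l: "reached l" "\<not> reached (Suc l)"
    by (metis nat_induct)
  then obtain t E where ph: "phase \<mu> \<nu> C f g l = Some (t, E)" "t \<le> s"
    by (auto simp: reached_def)
  have "ereal s < next_time \<mu> \<nu> C f g t E"
  proof (rule ccontr)
    assume "\<not> ?thesis"
    then have le: "next_time \<mu> \<nu> C f g t E \<le> ereal s" by simp
    then have "next_time \<mu> \<nu> C f g t E < \<infinity>" by auto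
    moreover from this obtain T where "next_time \<mu> \<nu> C f g t E = ereal T"
      using next_time_attained by blast
    ultimately have "reached (Suc l)" using ph le by (simp add: reached_def)
    then show False using l by simp
  qed
  then show thesis using that ph by blast
qed

lemma stays_on_pareto_frontier:
  assumes "0 \<le> s"
  shows "(f s, g s) \<in> pareto_frontier C"
proof -
  obtain l t E where ph: "phase \<mu> \<nu> C f g l = Some (t, E)" "t \<le> s"
    "ereal s < next_time \<mu> \<nu> C f g t E"
    using covering_phase[OF assms] by blast
  note inv = phase_invariant[OF ph(1)]
  obtain Q where "certificate \<mu> \<nu> E (v_star \<mu> \<nu> E) (w_star \<mu> \<nu> E) Q"
    using inv obtain_certificate by blast
  then show ?thesis
    using pareto_through_phase(1)[OF ph(1), of s Q] inv ph(2,3) by simp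
qed

end

theorem lemma3p1:
  fixes \<mu> :: "real ^ 'm" and \<nu> :: "real ^ 'n" and C :: "real ^ 'n ^ 'm"
    and f0 :: "real ^ 'm" and g0 :: "real ^ 'n"
    and f :: "real \<Rightarrow> real ^ 'm" and g :: "real \<Rightarrow> real ^ 'n"
  assumes "\<mu> \<in> prob_simplex" and "\<forall>i. \<mu> $ i > 0"
    and "\<nu> \<in> prob_simplex" and "\<forall>j. \<nu> $ j > 0"
    and "(f0, g0) \<in> pareto_frontier C"
    and "cold_sinkhorn \<mu> \<nu> C f0 g0 f g"
  shows "\<forall>t\<ge>0. (f t, g t) \<in> pareto_frontier C"
proof -
  have "f 0 = f0" "g 0 = g0" using assms(6) by (auto simp: cold_sinkhorn_def)
  then interpret cold_dynamics \<mu> \<nu> C f g using assms by unfold_locales auto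
  show ?thesis using stays_on_pareto_frontier by blast
qed

end
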